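(* Let $A^{(1)},\dots,A^{(K)}\in\mathbb{R}^{n\times n}$ be symmetric matrices, let $\boldsymbol{p}_k=[\underline{p}_k,\overline{p}_k]$, $k=1,\dots,K$, be compact real intervals, and let $\boldsymbol{p}=\boldsymbol{p}_1\times\dots\times\boldsymbol{p}_K$. For $p\in\mathbb{R}^K$ let $A(p)=\sum_{k=1}^K A^{(k)}p_k$. For each $k=1,\dots,K$, let $A^{(k)}=A^{(k)}_1-A^{(k)}_2$, where both $A^{(k)}_1,A^{(k)}_2\in\mathbb{R}^{n\times n}$ are positive semidefinite. If the parametric matrix $A(p)$, $p\in\boldsymbol{p}$, is weakly positive semidefinite, then the matrix $$\sum_{k=1}^K\left(A^{(k)}_1\overline{p}_k-A^{(k)}_2\underline{p}_k\right)$$ is positive semidefinite.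
   Context: The parametric matrix $A(p)$, $p\in\boldsymbol{p}$, is called weakly positive semidefinite if $A(p)$ is positive semidefinite for at least one $p\in\boldsymbol{p}$. Intervals satisfy $\underline{p}_k\le\overline{p}_k$. Positive semidefinite refers to real symmetric matrices. *)

theory Defs
  imports "HOL-Analysis.Analysis"
begin

definition symmetric_matrix :: "real ^ 'n ^ 'n \<Rightarrow> bool" where
  "symmetric_matrix M \<longleftrightarrow> transpose M = M"

definition positive_semidefinite :: "real ^ 'n ^ 'n \<Rightarrow> bool" where
  "positive_semidefinite M \<longleftrightarrow> symmetric_matrix M \<and> (\<forall>x. 0 \<le> x \<bullet> (M *v x))"

definition parametric_matrix ::
    "('k::finite \<Rightarrow> real ^ 'n ^ 'n) \<Rightarrow> real ^ 'k \<Rightarrow> real ^ 'n ^ 'n" where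
  "parametric_matrix A p = (\<Sum>k\<in>UNIV. p $ k *\<^sub>R A k)"

definition weakly_positive_semidefinite ::
    "('k::finite \<Rightarrow> real ^ 'n ^ 'n) \<Rightarrow> (real ^ 'k) set \<Rightarrow> bool" where
  "weakly_positive_semidefinite A P \<longleftrightarrow> (\<exists>p\<in>P. positive_semidefinite (parametric_matrix A p))"

end

theory Submission
  imports Defs
begin

text \<open>Positive semidefinite matrices form a convex cone. If \<open>p\<close> is a parameter for which
  \<open>A(p)\<close> is positive semidefinite, then the matrix in the conclusion is
  \<open>A(p)\<close> plus the correction
  \<open>\<Sum>k. (pu\<^sub>k - p\<^sub>k) A1\<^sub>k + (p\<^sub>k - pl\<^sub>k) A2\<^sub>k\<close>. Because \<open>p\<close> lies in the box, all
  coefficients of the correction are nonnegative, so it belongs to the cone, and so does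
  the total.\<close>

lemma positive_semidefinite_zero: "positive_semidefinite 0"
  by (simp add: positive_semidefinite_def symmetric_matrix_def transpose_def vec_eq_iff)

lemma positive_semidefinite_add:
  assumes "positive_semidefinite M" and "positive_semidefinite N"
  shows "positive_semidefinite (M + N)"
  using assms
  by (auto simp: positive_semidefinite_def symmetric_matrix_def transpose_def vec_eq_iff
      matrix_vector_mult_add_rdistrib inner_add_right)

lemma positive_semidefinite_scaleR:
  assumes "0 \<le> c" and "positive_semidefinite M"
  shows "positive_semidefinite (c *\<^sub>R M)"
  using assms
  by (auto simp: positive_semidefinite_def symmetric_matrix_def transpose_def vec_eq_iff
      scaleR_matrix_vector_assoc[symmetric])

lemma positive_semidefinite_sum:
  assumes "\<And>i. i \<in> I \<Longrightarrow> positive_semidefinite (M i)"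
  shows "positive_semidefinite (\<Sum>i\<in>I. M i)"
  using assms
  by (induction I rule: infinite_finite_induct)
    (auto intro: positive_semidefinite_zero positive_semidefinite_add)

theorem theorem6:
  fixes A A1 A2 :: "'k::finite \<Rightarrow> real ^ 'n ^ 'n"
    and pl pu :: "real ^ 'k"
  assumes "\<And>k. symmetric_matrix (A k)"
    and "\<And>k. pl $ k \<le> pu $ k"
    and "\<And>k. A k = A1 k - A2 k"
    and "\<And>k. positive_semidefinite (A1 k)"
    and "\<And>k. positive_semidefinite (A2 k)"
    and "weakly_positive_semidefinite A (cbox pl pu)"
  shows "positive_semidefinite (\<Sum>k\<in>UNIV. pu $ k *\<^sub>R A1 k - pl $ k *\<^sub>R A2 k)"
proof -
  obtain p where p: "p \<in> cbox pl pu" and psd: "positive_semidefinite (parametric_matrix A p)"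
    using assms(6) by (auto simp: weakly_positive_semidefinite_def)
  have bounds: "pl $ k \<le> p $ k" "p $ k \<le> pu $ k" for k
    using p by (auto simp: mem_box_cart)
  let ?C = "\<Sum>k\<in>UNIV. (pu $ k - p $ k) *\<^sub>R A1 k + (p $ k - pl $ k) *\<^sub>R A2 k"
  have "positive_semidefinite ?C"
    by (intro positive_semidefinite_sum positive_semidefinite_add positive_semidefinite_scaleR)
      (simp_all add: bounds assms(4,5))
  with psd have "positive_semidefinite (parametric_matrix A p + ?C)"
    by (rule positive_semidefinite_add)
  also have "parametric_matrix A p + ?C = (\<Sum>k\<in>UNIV. pu $ k *\<^sub>R A1 k - pl $ k *\<^sub>R A2 k)"
    unfolding parametric_matrix_def sum.distrib[symmetric]
    by (intro sum.cong) (simp_all add: assms(3) algebra_simps)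
  finally show ?thesis .
qed

end
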